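(* Let $P,\tilde P$ be probability measures on $\Xi_{1:T}$, let $r\ge1$, let $(c_t)_{t=0}^T$ be the cost process with terminal cost function $c$, and let $\pi(\cdot,\cdot)$ be the measure on $\Xi_{1:T}\times\Xi_{1:T}$ obtained by composing the optimal stagewise kernels (as defined in the context). Then the process $(c_t^r)_{t=1}^T$ is a martingale with respect to $\pi$ and the canonical filtration, i.e., $$c_t^r=\mathbb E_\pi\left(c_{t+1}^r\mid\mathcal F_t\otimes\mathcal F_t\right).$$
   Context: Spaces: $T\in\{1,2,\dots\}$; $(\Xi_t,d_t)$, $t=1,\dots,T$, are Polish spaces; the product $\Xi:=\Xi_{1:T}:=\Xi_1\times\dots\times\Xi_T$ is endowed with a metric $d$ such that $(\Xi,d)$ is Polish as well. Elements are $x_{1:T}=(x_1,\dots,x_T)$; $x_{1:t}=(x_1,\dots,x_t)$, and $x_{1:0}$ is the empty tuple. $\mathcal F_t$ is the sigma algebra generated by the coordinate projection $x_{1:T}\mapsto x_{1:t}$, $\mathcal F_0$ is trivial, and $\mathcal F_T$ is the Borel sigma algebra of $\Xi_{1:T}$. The canonical (coordinate) filtration on $\Xi_{1:T}\times\Xi_{1:T}$ is $(\mathcal F_t\otimes\mathcal F_t)_t$. For a Borel probability measure $P$ on $\Xi_{1:T}$, $P_t(\cdot\mid x_{1:t-1})$ is the regular kernel on $\Xi_t$ obtained by disintegration, i.e. the regular conditional distribution of the $t$-th coordinate given the first $t-1$ coordinates; likewise $\tilde P_t(\cdot\mid y_{1:t-1})$ for $\tilde P$. Wasserstein metric of order $r\in[1,\infty)$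 with respect to a real-valued cost function $c$: $w_r(\mu,\nu;c):=\inf_\pi\left(\iint c(x,y)^r\,\pi(dx,dy)\right)^{1/r}$, the infimum being over all bivariate probability measures with marginals $\mu$ and $\nu$. Cost process: let $c\colon\Xi_{1:T}\times\Xi_{1:T}\to\mathbb R$ be a lower semi-continuous function; put $c_T:=c$ (the terminal cost function) and, for $t=T,\dots,1$, $$c_{t-1}(x_{1:T},y_{1:T}):=w_r\bigl(P_t(\cdot\mid x_{1:t-1}),\tilde P_t(\cdot\mid y_{1:t-1});\,c_t\bigr),$$ where $c_t$ is regarded as a function of $(x_t,y_t)$ with $x_{1:t-1},y_{1:t-1}$ fixed. For $t<T$, $c_t$ thus depends on $(x_{1:T},y_{1:T})$ only through $(x_{1:t},y_{1:t})$. The cost process is $(c_t)_{t=0}^T$. The measure $\pi$: let $\pi_t(\cdot\times\cdot\mid x_{1:t-1},y_{1:t-1})$ denote the optimal kernels on $\Xi_t\times\Xi_t$ obtained in the recursion for $c_{t-1}$, i.e. the bivariate measures with marginals $P_t(\cdot\mid x_{1:t-1})$ and $\tilde P_t(\cdot\mid y_{1:t-1})$ for which the infimum in the definition of $c_{t-1}(x_{1:T},y_{1:T})$ is attained. (Their existence is asserted by appeal to a result of Brenier: for the quadratic cost $c(x,y)=\|x-y\|^2$ the infimum in the Wasserstein problem is attained at a unique bivariate measure if both measures have finite variance and do not give mass to small sets.) Then, for $A=A_1\times\dots\times A_T$ and $B=B_1\times\dots\times B_T$, $$\pi(A\times B):=\iint_{A_1\times B_1}\Bigl(\iint_{A_2\times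 B_2}\dots\Bigl(\iint_{A_T\times B_T}\pi_T(dx_T,dy_T\mid x_{1:T-1},y_{1:T-1})\Bigr)\dots\pi_2(dx_2,dy_2\mid x_1,y_1)\Bigr)\pi_1(dx_1,dy_1).$$
   Formalization: The martingale property is stated under the additional (necessary) assumption that c^r is integrable with respect to π; for c ≥ 0 the displayed identity is also stated without it, for conditional expectations with values in [0,∞]. *)

theory Defs
  imports "HOL-Probability.Probability"
begin

section \<open>Polish spaces, products and sigma algebras\<close>

definition polish_topology :: "'a topology \<Rightarrow> bool" where
  "polish_topology X \<longleftrightarrow> completely_metrizable_space X \<and>
     (\<exists>D. countable D \<and> D \<subseteq> topspace X \<and> X closure_of D = topspace X)"

definition borel_of :: "'a topology \<Rightarrow> 'a measure" where
  "borel_of X = sigma (topspace X) {U. openin X U}"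

definition lower_semicontinuous :: "'a topology \<Rightarrow> ('a \<Rightarrow> real) \<Rightarrow> bool" where
  "lower_semicontinuous X f \<longleftrightarrow> (\<forall>a. openin X {x \<in> topspace X. a < f x})"

text \<open>
  The spaces of the stages are topologies \<open>X t\<close> on a common carrier type; their underlying sets
  may differ.  A path over the stages in a set \<open>I\<close> is an extensional function on \<open>I\<close>.  The empty
  tuple is \<open>\<lambda>_. undefined\<close>.
\<close>

abbreviation path_algebra :: "(nat \<Rightarrow> 'a topology) \<Rightarrow> nat set \<Rightarrow> (nat \<Rightarrow> 'a) measure" where
  "path_algebra X I \<equiv> \<Pi>\<^sub>M t\<in>I. borel_of (X t)"

definition path_space :: "(nat \<Rightarrow> 'a topology) \<Rightarrow> nat \<Rightarrow> (nat \<Rightarrow> 'a) set" where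
  "path_space X T = (\<Pi>\<^sub>E t\<in>{1..T}. topspace (X t))"

definition coord_algebra :: "(nat \<Rightarrow> 'a topology) \<Rightarrow> nat \<Rightarrow> nat \<Rightarrow> (nat \<Rightarrow> 'a) measure" where
  "coord_algebra X T t =
     vimage_algebra (path_space X T) (\<lambda>x. restrict x {1..t}) (path_algebra X {1..t})"

definition canonical_filtration ::
    "(nat \<Rightarrow> 'a topology) \<Rightarrow> nat \<Rightarrow> nat \<Rightarrow> ((nat \<Rightarrow> 'a) \<times> (nat \<Rightarrow> 'a)) measure" where
  "canonical_filtration X T t = coord_algebra X T t \<Otimes>\<^sub>M coord_algebra X T t"

definition is_disintegration ::
    "(nat \<Rightarrow> 'a topology) \<Rightarrow> nat \<Rightarrow> (nat \<Rightarrow> 'a) measure \<Rightarrow> (nat \<Rightarrow> (nat \<Rightarrow> 'a) \<Rightarrow> 'a measure) \<Rightarrow> bool"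
where
  "is_disintegration X T P k \<longleftrightarrow> (\<forall>t\<in>{1..T}.
     k t \<in> path_algebra X {1..<t} \<rightarrow>\<^sub>M prob_algebra (borel_of (X t)) \<and>
     (\<forall>A\<in>sets (path_algebra X {1..<t}). \<forall>B\<in>sets (borel_of (X t)).
        emeasure P {x \<in> space P. restrict x {1..<t} \<in> A \<and> x t \<in> B} =
        (\<integral>\<^sup>+x\<in>{x \<in> space P. restrict x {1..<t} \<in> A}. emeasure (k t (restrict x {1..<t})) B \<partial>P)))"


section \<open>Powers, roots and integrals of extended real functions\<close>

text \<open>
  \<open>real_pow x r\<close> is the usual power whenever that is defined, that is for \<open>x \<ge> 0\<close> and for
  integers \<open>r\<close>; the library's \<open>powr\<close> ignores the sign of its base.  For \<open>x < 0\<close> and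
  non-integral \<open>r\<close> the power has no mathematical meaning and the value is \<open>\<bar>x\<bar> powr r\<close>.
\<close>

definition odd_exponent :: "real \<Rightarrow> bool" where
  "odd_exponent r \<longleftrightarrow> (\<exists>n::nat. odd n \<and> r = real n)"

definition real_pow :: "real \<Rightarrow> real \<Rightarrow> real" where
  "real_pow x r = (if x < 0 \<and> odd_exponent r then - (\<bar>x\<bar> powr r) else \<bar>x\<bar> powr r)"

lemma real_pow_nonneg: "0 \<le> x \<Longrightarrow> real_pow x r = x powr r"
  by (simp add: real_pow_def)

lemma real_pow_nat:
  assumes "0 < n"
  shows "real_pow x (real n) = x ^ n"
proof (cases "x < 0")
  case True
  then have "(- x) powr real n = (- x) ^ n"
    using assms by (intro powr_realpow') auto
  then show ?thesis
    using True by (cases "even n") (auto simp: real_pow_def odd_exponent_def)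
next
  case False
  then have "x powr real n = x ^ n"
    using assms by (intro powr_realpow') auto
  then show ?thesis
    using False by (simp add: real_pow_def)
qed

definition ereal_pow :: "ereal \<Rightarrow> real \<Rightarrow> ereal" where
  "ereal_pow x r =
     (if \<bar>x\<bar> = \<infinity> then (if odd_exponent r then x else \<infinity>) else ereal (real_pow (real_of_ereal x) r))"

text \<open>
  The power \<open>1 / r\<close>.  Below it is applied to integrals of \<open>r\<close>-th powers, which can be negative
  only if \<open>r\<close> is an odd integer.
\<close>

definition ereal_root :: "real \<Rightarrow> ereal \<Rightarrow> ereal" where
  "ereal_root r x =
     (if \<bar>x\<bar> = \<infinity> then x
      else ereal (sgn (real_of_ereal x) * \<bar>real_of_ereal x\<bar> powr (1 / r)))"

text \<open>
  Positive minus negative part.  In type \<open>ereal\<close> one has \<open>\<infinity> - \<infinity> = \<infinity>\<close>, so that a coupling with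
  undefined integral does not contribute to the infimum in \<open>wasserstein\<close>.
\<close>

definition ereal_integral :: "'a measure \<Rightarrow> ('a \<Rightarrow> ereal) \<Rightarrow> ereal" where
  "ereal_integral M f =
     enn2ereal (\<integral>\<^sup>+x. e2ennreal (f x) \<partial>M) - enn2ereal (\<integral>\<^sup>+x. e2ennreal (- f x) \<partial>M)"

lemma ereal_integral_integrable:
  assumes "integrable M f"
  shows "ereal_integral M (\<lambda>x. ereal (f x)) = ereal (\<integral>x. f x \<partial>M)"
proof -
  have f: "f \<in> borel_measurable M" "(\<integral>\<^sup>+x. ennreal (f x) \<partial>M) \<noteq> \<infinity>" "(\<integral>\<^sup>+x. ennreal (- f x) \<partial>M) \<noteq> \<infinity>"
    using assms by (auto simp: real_integrable_def)
  obtain a b where ab: "(\<integral>\<^sup>+x. ennreal (f x) \<partial>M) = ennreal a" "0 \<le> a"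
      "(\<integral>\<^sup>+x. ennreal (- f x) \<partial>M) = ennreal b" "0 \<le> b"
    using f by (metis ennreal_cases infinity_ennreal_def)
  show ?thesis
    unfolding real_lebesgue_integral_def[OF assms] ereal_integral_def
    by (simp add: ab enn2ereal_ennreal flip: ennreal.abs_eq)
qed

lemma ereal_pow_root:
  assumes "1 \<le> r" "odd_exponent r \<or> 0 \<le> x"
  shows "ereal_pow (ereal_root r x) r = x"
proof (cases x)
  case (real y)
  have "(\<bar>y\<bar> powr (1 / r)) powr r = \<bar>y\<bar>"
    using assms by (simp add: powr_powr)
  then show ?thesis
    using real assms
    by (auto simp: ereal_pow_def ereal_root_def real_pow_def sgn_if abs_mult mult_less_0_iff)
qed (use assms in \<open>auto simp: ereal_pow_def ereal_root_def\<close>)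


section \<open>Wasserstein costs and the cost process\<close>

definition couplings :: "'a measure \<Rightarrow> 'b measure \<Rightarrow> ('a \<times> 'b) measure set" where
  "couplings \<mu> \<nu> =
     {\<pi>. prob_space \<pi> \<and> sets \<pi> = sets (\<mu> \<Otimes>\<^sub>M \<nu>) \<and> distr \<pi> \<mu> fst = \<mu> \<and> distr \<pi> \<nu> snd = \<nu>}"

definition transport_cost :: "real \<Rightarrow> ('a \<times> 'b) measure \<Rightarrow> ('a \<times> 'b \<Rightarrow> ereal) \<Rightarrow> ereal" where
  "transport_cost r \<pi> c = ereal_root r (ereal_integral \<pi> (\<lambda>z. ereal_pow (c z) r))"

definition wasserstein ::
    "real \<Rightarrow> 'a measure \<Rightarrow> 'b measure \<Rightarrow> ('a \<times> 'b \<Rightarrow> ereal) \<Rightarrow> ereal" where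
  "wasserstein r \<mu> \<nu> c = (INF \<pi>\<in>couplings \<mu> \<nu>. transport_cost r \<pi> c)"

definition optimal_coupling ::
    "real \<Rightarrow> 'a measure \<Rightarrow> 'b measure \<Rightarrow> ('a \<times> 'b \<Rightarrow> ereal) \<Rightarrow> ('a \<times> 'b) measure \<Rightarrow> bool" where
  "optimal_coupling r \<mu> \<nu> c \<pi> \<longleftrightarrow>
     \<pi> \<in> couplings \<mu> \<nu> \<and> transport_cost r \<pi> c = wasserstein r \<mu> \<nu> c"

text \<open>
  \<open>stage_cost t x y f\<close> is \<open>f\<close> as a function of the pair of \<open>t\<close>-th coordinates.  It is only used for
  \<open>f\<close> that do not depend on coordinates after \<open>t\<close>, with coordinates before \<open>t\<close> taken from \<open>x, y\<close>.
\<close>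

definition stage_cost ::
    "nat \<Rightarrow> (nat \<Rightarrow> 'a) \<Rightarrow> (nat \<Rightarrow> 'a) \<Rightarrow> ((nat \<Rightarrow> 'a) \<times> (nat \<Rightarrow> 'a) \<Rightarrow> ereal) \<Rightarrow> 'a \<times> 'a \<Rightarrow> ereal"
where
  "stage_cost t x y f = (\<lambda>(u, v). f (x(t := u), y(t := v)))"

primrec cost_backward ::
    "nat \<Rightarrow> real \<Rightarrow> (nat \<Rightarrow> (nat \<Rightarrow> 'a) \<Rightarrow> 'a measure) \<Rightarrow> (nat \<Rightarrow> (nat \<Rightarrow> 'a) \<Rightarrow> 'a measure) \<Rightarrow>
     ((nat \<Rightarrow> 'a) \<times> (nat \<Rightarrow> 'a) \<Rightarrow> real) \<Rightarrow> nat \<Rightarrow> (nat \<Rightarrow> 'a) \<times> (nat \<Rightarrow> 'a) \<Rightarrow> ereal"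
where
  "cost_backward T r p q c 0 = (\<lambda>z. ereal (c z))"
| "cost_backward T r p q c (Suc n) = (\<lambda>(x, y).
     wasserstein r (p (T - n) (restrict x {1..<T - n})) (q (T - n) (restrict y {1..<T - n}))
       (stage_cost (T - n) x y (cost_backward T r p q c n)))"

definition cost_process ::
    "nat \<Rightarrow> real \<Rightarrow> (nat \<Rightarrow> (nat \<Rightarrow> 'a) \<Rightarrow> 'a measure) \<Rightarrow> (nat \<Rightarrow> (nat \<Rightarrow> 'a) \<Rightarrow> 'a measure) \<Rightarrow>
     ((nat \<Rightarrow> 'a) \<times> (nat \<Rightarrow> 'a) \<Rightarrow> real) \<Rightarrow> nat \<Rightarrow> (nat \<Rightarrow> 'a) \<times> (nat \<Rightarrow> 'a) \<Rightarrow> ereal"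
where
  "cost_process T r p q c t = cost_backward T r p q c (T - t)"

lemma cost_process_terminal: "cost_process T r p q c T z = ereal (c z)"
  by (simp add: cost_process_def)

lemma cost_process_step:
  assumes "1 \<le> t" "t \<le> T"
  shows "cost_process T r p q c (t - 1) (x, y) =
    wasserstein r (p t (restrict x {1..<t})) (q t (restrict y {1..<t}))
      (stage_cost t x y (cost_process T r p q c t))"
proof -
  have "T - (t - 1) = Suc (T - t)" "T - (T - t) = t"
    using assms by auto
  then show ?thesis
    by (simp add: cost_process_def)
qed

definition optimal_kernels ::
    "(nat \<Rightarrow> 'a topology) \<Rightarrow> nat \<Rightarrow> real \<Rightarrow>
     (nat \<Rightarrow> (nat \<Rightarrow> 'a) \<Rightarrow> 'a measure) \<Rightarrow> (nat \<Rightarrow> (nat \<Rightarrow> 'a) \<Rightarrow> 'a measure) \<Rightarrow>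
     ((nat \<Rightarrow> 'a) \<times> (nat \<Rightarrow> 'a) \<Rightarrow> real) \<Rightarrow>
     (nat \<Rightarrow> (nat \<Rightarrow> 'a) \<times> (nat \<Rightarrow> 'a) \<Rightarrow> ('a \<times> 'a) measure) \<Rightarrow> bool"
where
  "optimal_kernels X T r p q c k \<longleftrightarrow> (\<forall>t\<in>{1..T}.
     k t \<in> path_algebra X {1..<t} \<Otimes>\<^sub>M path_algebra X {1..<t}
             \<rightarrow>\<^sub>M prob_algebra (borel_of (X t) \<Otimes>\<^sub>M borel_of (X t)) \<and>
     (\<forall>x\<in>space (path_algebra X {1..<t}). \<forall>y\<in>space (path_algebra X {1..<t}).
        optimal_coupling r (p t x) (q t y) (stage_cost t x y (cost_process T r p q c t)) (k t (x, y))))"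


section \<open>Composition of the stagewise kernels\<close>

text \<open>
  \<open>rect_mass T k A B n (x, y)\<close> is the iterated integral over the last \<open>n\<close> stages
  \<open>T - n + 1, \<dots>, T\<close>, given the paths \<open>x\<close> and \<open>y\<close> up to stage \<open>T - n\<close>.
\<close>

primrec rect_mass ::
    "nat \<Rightarrow> (nat \<Rightarrow> (nat \<Rightarrow> 'a) \<times> (nat \<Rightarrow> 'a) \<Rightarrow> ('a \<times> 'a) measure) \<Rightarrow>
     (nat \<Rightarrow> 'a set) \<Rightarrow> (nat \<Rightarrow> 'a set) \<Rightarrow> nat \<Rightarrow> (nat \<Rightarrow> 'a) \<times> (nat \<Rightarrow> 'a) \<Rightarrow> ennreal"
where
  "rect_mass T k A B 0 = (\<lambda>z. 1)"
| "rect_mass T k A B (Suc n) = (\<lambda>(x, y).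
     \<integral>\<^sup>+w\<in>A (T - n) \<times> B (T - n).
        rect_mass T k A B n (x(T - n := fst w), y(T - n := snd w)) \<partial>k (T - n) (x, y))"

definition is_composition ::
    "(nat \<Rightarrow> 'a topology) \<Rightarrow> nat \<Rightarrow> (nat \<Rightarrow> (nat \<Rightarrow> 'a) \<times> (nat \<Rightarrow> 'a) \<Rightarrow> ('a \<times> 'a) measure) \<Rightarrow>
     ((nat \<Rightarrow> 'a) \<times> (nat \<Rightarrow> 'a)) measure \<Rightarrow> bool"
where
  "is_composition X T k \<pi> \<longleftrightarrow>
     sets \<pi> = sets (path_algebra X {1..T} \<Otimes>\<^sub>M path_algebra X {1..T}) \<and>
     (\<forall>A B. (\<forall>t\<in>{1..T}. A t \<in> sets (borel_of (X t)) \<and> B t \<in> sets (borel_of (X t))) \<longrightarrow>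
        emeasure \<pi> (PiE {1..T} A \<times> PiE {1..T} B) =
        rect_mass T k A B T (\<lambda>_. undefined, \<lambda>_. undefined))"


section \<open>Martingales\<close>

definition martingale_on ::
    "'a measure \<Rightarrow> 't::linorder set \<Rightarrow> ('t \<Rightarrow> 'a measure) \<Rightarrow> ('t \<Rightarrow> 'a \<Rightarrow> real) \<Rightarrow> bool" where
  "martingale_on M I F Z \<longleftrightarrow>
     (\<forall>t\<in>I. subalgebra M (F t) \<and> Z t \<in> borel_measurable (F t) \<and> integrable M (Z t)) \<and>
     (\<forall>s\<in>I. \<forall>t\<in>I. s \<le> t \<longrightarrow>
        subalgebra (F t) (F s) \<and> (AE \<omega> in M. Z s \<omega> = real_cond_exp M (F s) (Z t) \<omega>))"

end

theory Submission
  imports Defs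
begin

text \<open>
  The optimal kernel \<open>\<pi>\<^sub>t\<close> attains the infimum that defines \<open>c\<^bsub>t-1\<^esub>\<close>.  Raising the attained value
  to the power \<open>r\<close> undoes the root in the Wasserstein cost and leaves
  \<open>c\<^bsub>t-1\<^esub>\<^sup>r = \<integral> c\<^sub>t\<^sup>r d\<pi>\<^sub>t\<close>, the integral being taken over the pair of \<open>t\<close>-th coordinates with the
  earlier coordinates fixed (\<open>C_step\<close>).  On the other hand \<open>\<pi>\<^sub>t\<close> is the conditional law under \<open>\<pi>\<close>
  of the \<open>t\<close>-th pair given the earlier ones, because \<open>\<pi>\<close> is composed of these kernels
  (\<open>composition_eq_law\<close>, \<open>nn_cond_exp_truncate\<close>).  Hence the integral is the conditional
  expectation of \<open>c\<^sub>t\<^sup>r\<close> given \<open>\<F>\<^bsub>t-1\<^esub> \<otimes> \<F>\<^bsub>t-1\<^esub>\<close>.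

  Two points need care.  The values of the cost process are extended reals and can have either
  sign when \<open>r\<close> is an odd integer.  The argument is therefore carried out for the positive and the
  negative part separately, whose integrals exist in \<open>[0, \<infinity>]\<close>; if \<open>c\<^sup>r\<close> is integrable, then both
  parts have finite integrals at every stage, so that they are finite almost everywhere and can be
  subtracted (\<open>real_cond_exp_step\<close>).  Moreover all \<open>c\<^sub>t\<close> have to be measurable.  An infimum over
  uncountably many couplings need not be, but the formula for \<open>c\<^bsub>t-1\<^esub>\<^sup>r\<close> with the measurable kernel
  \<open>\<pi>\<^sub>t\<close> passes measurability of \<open>c\<^sub>t\<^sup>r\<close> on to \<open>c\<^bsub>t-1\<^esub>\<^sup>r\<close>, starting from the lower semicontinuous \<open>c\<close>.
\<close>


section \<open>Borel measurability of lower semicontinuous functions\<close>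

lemma space_borel_of [simp]: "space (borel_of X) = topspace X"
  by (simp add: borel_of_def space_measure_of_conv)

lemma sets_borel_of: "sets (borel_of X) = sigma_sets (topspace X) {U. openin X U}"
  unfolding borel_of_def by (rule sets_measure_of) (auto dest: openin_subset)

lemma openin_in_sets_borel_of: "openin X U \<Longrightarrow> U \<in> sets (borel_of X)"
  by (auto simp: sets_borel_of)

lemma (in Metric_space) second_countable_mtopology:
  assumes "polish_topology mtopology"
  shows "second_countable mtopology"
proof -
  obtain D where D: "countable D" "D \<subseteq> M" "mtopology closure_of D = M"
    using assms by (auto simp: polish_topology_def)
  let ?B = "(\<lambda>(a, n). mball a (1 / real (Suc n))) ` (D \<times> UNIV)"
  have "\<exists>V\<in>?B. x \<in> V \<and> V \<subseteq> U" if U: "openin mtopology U" "x \<in> U" for U x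
  proof -
    obtain e where e: "0 < e" "mball x e \<subseteq> U" and x: "x \<in> M"
      using U openin_mtopology by (metis subsetD)
    obtain n where n: "1 / real (Suc n) < e / 2"
      using e by (metis half_gt_zero nat_approx_posE)
    have "x \<in> mtopology closure_of D"
      using D x by simp
    then have "\<forall>e>0. \<exists>a\<in>D. a \<in> mball x e"
      unfolding metric_closure_of by blast
    then obtain a where a: "a \<in> D" "a \<in> mball x (1 / real (Suc n))"
      by (metis of_nat_0_less_iff zero_less_Suc zero_less_divide_1_iff)
    have "mball a (1 / real (Suc n)) \<subseteq> mball x e"
      using a n x by (intro mball_subset) (auto simp: commute)
    moreover have "x \<in> mball a (1 / real (Suc n))"
      using a by (auto simp: commute)
    ultimately show ?thesis
      using a e by (intro bexI[of _ "mball a (1 / real (Suc n))"]) auto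
  qed
  moreover have "countable ?B"
    using D by (intro countable_image countable_SIGMA) auto
  ultimately show ?thesis
    unfolding second_countable_def by (intro exI[of _ ?B]) auto
qed

text \<open>
  Second countability is what makes open sets of the product measurable for the product sigma
  algebra: they are countable unions of open rectangles.
\<close>

lemma openin_prod_topology_in_sets_borel_of_product:
  assumes "second_countable X" "second_countable Y" and W: "openin (prod_topology X Y) W"
  shows "W \<in> sets (borel_of X \<Otimes>\<^sub>M borel_of Y)"
proof -
  obtain B where B: "countable B" "\<And>V. V \<in> B \<Longrightarrow> openin X V"
      "\<And>U x. openin X U \<Longrightarrow> x \<in> U \<Longrightarrow> \<exists>V\<in>B. x \<in> V \<and> V \<subseteq> U"
    using assms(1) unfolding second_countable_def by metis
  obtain B' where B': "countable B'" "\<And>V. V \<in> B' \<Longrightarrow> openin Y V"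
      "\<And>U x. openin Y U \<Longrightarrow> x \<in> U \<Longrightarrow> \<exists>V\<in>B'. x \<in> V \<and> V \<subseteq> U"
    using assms(2) unfolding second_countable_def by metis
  let ?I = "{(V, V'). V \<in> B \<and> V' \<in> B' \<and> V \<times> V' \<subseteq> W}"
  have "countable ?I"
    by (rule countable_subset[of _ "B \<times> B'"]) (use B B' in auto)
  moreover have "z \<in> (\<Union>(V, V')\<in>?I. V \<times> V')" if "z \<in> W" for z
  proof -
    obtain U U' where U: "openin X U" "openin Y U'" "fst z \<in> U" "snd z \<in> U'" "U \<times> U' \<subseteq> W"
      using W \<open>z \<in> W\<close> unfolding openin_prod_topology_alt by (metis prod.collapse)
    obtain V V' where "V \<in> B" "fst z \<in> V" "V \<subseteq> U" "V' \<in> B'" "snd z \<in> V'" "V' \<subseteq> U'"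
      using B(3)[OF U(1,3)] B'(3)[OF U(2,4)] by auto
    moreover from this have "V \<times> V' \<subseteq> W"
      using U(5) by blast
    ultimately show ?thesis
      by (intro UN_I[of "(V, V')"]) (auto simp: mem_Times_iff)
  qed
  then have "W = (\<Union>(V, V')\<in>?I. V \<times> V')"
    by blast
  moreover have "(\<Union>(V, V')\<in>?I. V \<times> V') \<in> sets (borel_of X \<Otimes>\<^sub>M borel_of Y)"
    using \<open>countable ?I\<close> B(2) B'(2)
    by (intro sets.countable_UN') (auto intro!: pair_measureI openin_in_sets_borel_of)
  ultimately show ?thesis
    by simp
qed

lemma lower_semicontinuous_borel_measurable:
  assumes "second_countable X" "second_countable Y"
    and f: "lower_semicontinuous (prod_topology X Y) f"
  shows "f \<in> borel_measurable (borel_of X \<Otimes>\<^sub>M borel_of Y)"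
proof (rule borel_measurableI_greater)
  fix a
  have "{z \<in> topspace (prod_topology X Y). a < f z} \<in> sets (borel_of X \<Otimes>\<^sub>M borel_of Y)"
    using f by (intro openin_prod_topology_in_sets_borel_of_product assms)
      (auto simp: lower_semicontinuous_def)
  then show "{z \<in> space (borel_of X \<Otimes>\<^sub>M borel_of Y). a < f z} \<in> sets (borel_of X \<Otimes>\<^sub>M borel_of Y)"
    by (simp add: space_pair_measure)
qed


section \<open>Powers of optimal transport costs\<close>

lemma borel_measurable_real_pow [measurable (raw)]:
  assumes [measurable]: "f \<in> borel_measurable M"
  shows "(\<lambda>x. real_pow (f x) r) \<in> borel_measurable M"
  unfolding real_pow_def by measurable

lemma ereal_pow_nonneg: "\<not> odd_exponent r \<or> 0 \<le> x \<Longrightarrow> 0 \<le> ereal_pow x r"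
  by (cases x) (auto simp: ereal_pow_def real_pow_def)

lemma ereal_integral_nonneg:
  assumes "\<And>x. x \<in> space M \<Longrightarrow> 0 \<le> f x"
  shows "ereal_integral M f = enn2ereal (\<integral>\<^sup>+x. e2ennreal (f x) \<partial>M)"
proof -
  have "(\<integral>\<^sup>+x. e2ennreal (- f x) \<partial>M) = 0"
    using assms by (intro nn_integral_zero' AE_I2) (auto simp: e2ennreal_neg)
  then show ?thesis
    by (simp add: ereal_integral_def zero_ennreal.rep_eq)
qed

text \<open>
  The power cancels the root except at negative numbers with \<open>r\<close> not an odd integer; but for such
  \<open>r\<close> the integrand, an \<open>r\<close>-th power, is nonnegative.
\<close>

lemma ereal_pow_transport_cost:
  assumes "1 \<le> r"
  shows "ereal_pow (transport_cost r \<pi> c) r = ereal_integral \<pi> (\<lambda>w. ereal_pow (c w) r)"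
proof (cases "odd_exponent r")
  case False
  then have "0 \<le> ereal_integral \<pi> (\<lambda>w. ereal_pow (c w) r)"
    by (subst ereal_integral_nonneg) (auto intro: ereal_pow_nonneg)
  then show ?thesis
    using assms by (simp add: transport_cost_def ereal_pow_root)
qed (use assms in \<open>simp add: transport_cost_def ereal_pow_root\<close>)


section \<open>Composition of kernels on pairs of paths\<close>

definition extend :: "nat \<Rightarrow> (nat \<Rightarrow> 'a) \<times> (nat \<Rightarrow> 'a) \<Rightarrow> 'a \<times> 'a \<Rightarrow> (nat \<Rightarrow> 'a) \<times> (nat \<Rightarrow> 'a)" where
  "extend t z w = ((fst z)(t := fst w), (snd z)(t := snd w))"

definition truncate :: "nat \<Rightarrow> (nat \<Rightarrow> 'a) \<times> (nat \<Rightarrow> 'a) \<Rightarrow> (nat \<Rightarrow> 'a) \<times> (nat \<Rightarrow> 'a)" where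
  "truncate t z = (restrict (fst z) {1..t}, restrict (snd z) {1..t})"

lemma truncate_truncate: "s \<le> t \<Longrightarrow> truncate s (truncate t z) = truncate s z"
  by (auto simp: truncate_def restrict_def fun_eq_iff)

lemma stage_cost_eq_extend: "stage_cost t x y f = (\<lambda>w. f (extend t (x, y) w))"
  by (auto simp: stage_cost_def extend_def)

locale path_pair_kernels =
  fixes M :: "nat \<Rightarrow> 'a measure"
    and K :: "nat \<Rightarrow> (nat \<Rightarrow> 'a) \<times> (nat \<Rightarrow> 'a) \<Rightarrow> ('a \<times> 'a) measure"
    and T :: nat
  assumes kernel: "\<And>t. t < T \<Longrightarrow>
    K (Suc t) \<in> PiM {1..t} M \<Otimes>\<^sub>M PiM {1..t} M \<rightarrow>\<^sub>M prob_algebra (M (Suc t) \<Otimes>\<^sub>M M (Suc t))"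
begin

abbreviation paths :: "nat \<Rightarrow> ((nat \<Rightarrow> 'a) \<times> (nat \<Rightarrow> 'a)) measure" where
  "paths t \<equiv> PiM {1..t} M \<Otimes>\<^sub>M PiM {1..t} M"

text \<open>
  The transition operator of the Markov chain whose state at time \<open>t\<close> is the whole pair of paths
  up to \<open>t\<close>; it maps functions of the state at \<open>t\<close> to functions of the state at \<open>t - 1\<close>.
\<close>

definition step :: "nat \<Rightarrow> ((nat \<Rightarrow> 'a) \<times> (nat \<Rightarrow> 'a) \<Rightarrow> ennreal) \<Rightarrow> (nat \<Rightarrow> 'a) \<times> (nat \<Rightarrow> 'a) \<Rightarrow> ennreal"
  where "step t f z = (\<integral>\<^sup>+w. f (extend t z w) \<partial>K t z)"

text \<open>
  The forward construction of the composed measure.  Its one-step recursion gives direct access to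
  the law of the first \<open>t\<close> stages, which the iterated integral over all stages does not.
\<close>

primrec law :: "nat \<Rightarrow> ((nat \<Rightarrow> 'a) \<times> (nat \<Rightarrow> 'a)) measure" where
  "law 0 = return (paths 0) (\<lambda>_. undefined, \<lambda>_. undefined)"
| "law (Suc t) = law t \<bind> (\<lambda>z. distr (K (Suc t) z) (paths (Suc t)) (extend (Suc t) z))"

lemma measurable_extend [measurable]:
  "(\<lambda>(z, w). extend (Suc t) z w) \<in> paths t \<Otimes>\<^sub>M (M (Suc t) \<Otimes>\<^sub>M M (Suc t)) \<rightarrow>\<^sub>M paths (Suc t)"
proof -
  have I: "{1..Suc t} = {1..t} \<union> {Suc t}"
    by auto
  show ?thesis
    unfolding extend_def split_beta'
    by (intro measurable_Pair measurable_fun_upd[OF I]) measurable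
qed

lemma measurable_truncate:
  assumes "t \<le> n"
  shows "truncate t \<in> paths n \<rightarrow>\<^sub>M paths t"
proof -
  have "(\<lambda>x. restrict x {1..t}) \<in> PiM {1..n} M \<rightarrow>\<^sub>M PiM {1..t} M"
    using assms by (intro measurable_restrict_subset) auto
  then show ?thesis
    unfolding truncate_def by measurable
qed

lemma truncate_paths: "z \<in> space (paths t) \<Longrightarrow> truncate t z = z"
  by (cases z) (auto simp: truncate_def space_pair_measure space_PiM)

lemma truncate_extend:
  assumes "t \<le> n"
  shows "truncate t (extend (Suc n) z w) = truncate t z"
  using assms by (auto simp: truncate_def extend_def restrict_def fun_eq_iff)

lemma kernel_subprob:
  "t < T \<Longrightarrow> K (Suc t) \<in> paths t \<rightarrow>\<^sub>M subprob_algebra (M (Suc t) \<Otimes>\<^sub>M M (Suc t))"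
  by (intro measurable_prob_algebraD kernel)

lemma kernel_prob_space:
  assumes "t < T" "z \<in> space (paths t)"
  shows "prob_space (K (Suc t) z)" "sets (K (Suc t) z) = sets (M (Suc t) \<Otimes>\<^sub>M M (Suc t))"
    "space (K (Suc t) z) = space (M (Suc t) \<Otimes>\<^sub>M M (Suc t))"
  using measurable_space[OF kernel[OF assms(1)] assms(2)]
  by (auto simp: space_prob_algebra dest: sets_eq_imp_space_eq)

lemma extend_paths:
  assumes "t < T" "z \<in> space (paths t)" "w \<in> space (K (Suc t) z)"
  shows "extend (Suc t) z w \<in> space (paths (Suc t))"
proof -
  have "(z, w) \<in> space (paths t \<Otimes>\<^sub>M (M (Suc t) \<Otimes>\<^sub>M M (Suc t)))"
    using assms by (subst space_pair_measure) (simp add: kernel_prob_space)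
  then show ?thesis
    using measurable_space[OF measurable_extend[of t]] by fastforce
qed

lemma measurable_step:
  assumes "t < T" and [measurable]: "f \<in> borel_measurable (paths (Suc t))"
  shows "step (Suc t) f \<in> borel_measurable (paths t)"
  unfolding step_def
  by (intro nn_integral_measurable_subprob_algebra2[OF _ kernel_subprob] assms)
    measurable

lemma law_kernel:
  assumes "t < T"
  shows "(\<lambda>z. distr (K (Suc t) z) (paths (Suc t)) (extend (Suc t) z))
    \<in> paths t \<rightarrow>\<^sub>M prob_algebra (paths (Suc t))"
  by (intro measurable_distr_prob_space2[OF kernel] assms measurable_extend)

lemma law_prob_algebra: "t \<le> T \<Longrightarrow> law t \<in> space (prob_algebra (paths t))"
proof (induction t)
  case 0
  have "prob_space (return (paths 0) (\<lambda>_. undefined, \<lambda>_. undefined))"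
    by (intro prob_space_return) (auto simp: space_pair_measure space_PiM)
  then show ?case
    by (simp add: space_prob_algebra)
next
  case (Suc t)
  then have t: "t < T" "law t \<in> space (prob_algebra (paths t))"
    by auto
  show ?case
    using prob_space_bind'[OF t(2) law_kernel[OF t(1)]] sets_bind'[OF t(2) law_kernel[OF t(1)]]
    by (simp add: space_prob_algebra)
qed

lemma
  assumes "t \<le> T"
  shows prob_space_law: "prob_space (law t)"
    and sets_law: "sets (law t) = sets (paths t)"
    and space_law: "space (law t) = space (paths t)"
  using law_prob_algebra[OF assms] by (auto simp: space_prob_algebra dest: sets_eq_imp_space_eq)

lemma nn_integral_law_Suc:
  assumes t: "t < T" and f: "f \<in> borel_measurable (paths (Suc t))"
  shows "(\<integral>\<^sup>+z. f z \<partial>law (Suc t)) = (\<integral>\<^sup>+z. step (Suc t) f z \<partial>law t)"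
proof -
  have "(\<integral>\<^sup>+z. f z \<partial>law (Suc t)) =
      (\<integral>\<^sup>+z. \<integral>\<^sup>+z'. f z' \<partial>distr (K (Suc t) z) (paths (Suc t)) (extend (Suc t) z) \<partial>law t)"
    unfolding law.simps
    using t law_kernel[OF t, THEN measurable_prob_algebraD]
    by (intro nn_integral_bind[OF f]) (simp cong: measurable_cong_sets add: sets_law)
  also have "\<dots> = (\<integral>\<^sup>+z. step (Suc t) f z \<partial>law t)"
  proof (rule nn_integral_cong)
    fix z assume "z \<in> space (law t)"
    then have z: "z \<in> space (paths t)"
      using t by (simp add: space_law)
    have "extend (Suc t) z \<in> K (Suc t) z \<rightarrow>\<^sub>M paths (Suc t)"
      using measurable_Pair2[OF measurable_extend z] kernel_prob_space[OF t z]
      by (simp cong: measurable_cong_sets)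
    then show "(\<integral>\<^sup>+z'. f z' \<partial>distr (K (Suc t) z) (paths (Suc t)) (extend (Suc t) z)) = step (Suc t) f z"
      unfolding step_def using f by (intro nn_integral_distr) simp_all
  qed
  finally show ?thesis .
qed

text \<open>
  The kernels are probability measures, so integrating out the stages after \<open>t\<close> changes nothing:
  \<open>law t\<close> is the marginal of \<open>law n\<close> on the first \<open>t\<close> stages.
\<close>

lemma nn_integral_law_truncate:
  assumes "t \<le> n" "n \<le> T" and f: "f \<in> borel_measurable (paths t)"
  shows "(\<integral>\<^sup>+z. f (truncate t z) \<partial>law n) = (\<integral>\<^sup>+z. f z \<partial>law t)"
  using assms(1,2)
proof (induction n rule: dec_induct)
  case base
  then show ?case
    by (intro nn_integral_cong) (simp add: space_law truncate_paths)
next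
  case (step n)
  then have n: "n < T"
    by simp
  have "(\<integral>\<^sup>+z. f (truncate t z) \<partial>law (Suc n)) =
      (\<integral>\<^sup>+z. step (Suc n) (\<lambda>z. f (truncate t z)) z \<partial>law n)"
    using step by (intro nn_integral_law_Suc measurable_compose[OF measurable_truncate f]) auto
  also have "\<dots> = (\<integral>\<^sup>+z. f (truncate t z) \<partial>law n)"
    using n step(1) prob_space.emeasure_space_1[OF kernel_prob_space(1)[OF n]]
    by (intro nn_integral_cong) (simp add: step_def truncate_extend space_law)
  finally show ?case
    using step by simp
qed

lemma measurable_rect_mass:
  assumes "t \<le> T"
    and AB: "\<And>s. s \<in> {1..T} \<Longrightarrow> A s \<in> sets (M s) \<and> B s \<in> sets (M s)"
  shows "rect_mass T K A B (T - t) \<in> borel_measurable (paths t)"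
  using assms(1)
proof (induction t rule: inc_induct)
  case (step t)
  then have T: "T - t = Suc (T - Suc t)" "T - (T - Suc t) = Suc t"
    by auto
  have [measurable]: "A (Suc t) \<in> sets (M (Suc t))" "B (Suc t) \<in> sets (M (Suc t))"
    using AB[of "Suc t"] step by auto
  note [measurable] = step(3)
  have "(\<lambda>z. \<integral>\<^sup>+w\<in>A (Suc t) \<times> B (Suc t).
      rect_mass T K A B (T - Suc t) (extend (Suc t) z w) \<partial>K (Suc t) z) \<in> borel_measurable (paths t)"
    using step by (intro nn_integral_measurable_subprob_algebra2[OF _ kernel_subprob]) measurable
  then show ?case
    unfolding T(1) rect_mass.simps T(2) by (simp add: extend_def split_beta')
qed simp

text \<open>
  The forward recursion for \<open>law\<close> and the backward recursion for \<open>rect_mass\<close> meet at any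
  intermediate stage \<open>t\<close>: the left-hand side is constant in \<open>t\<close>.  For \<open>t = T\<close> it is the mass of the
  full rectangle under \<open>law T\<close>.
\<close>

lemma nn_integral_law_rect_mass:
  assumes "t \<le> T"
    and AB: "\<And>s. s \<in> {1..T} \<Longrightarrow> A s \<in> sets (M s) \<and> B s \<in> sets (M s)"
  shows "(\<integral>\<^sup>+z\<in>PiE {1..t} A \<times> PiE {1..t} B. rect_mass T K A B (T - t) z \<partial>law t) =
    rect_mass T K A B T (\<lambda>_. undefined, \<lambda>_. undefined)"
  using assms(1)
proof (induction t)
  case 0
  let ?u = "(\<lambda>_. undefined, \<lambda>_. undefined) :: (nat \<Rightarrow> 'a) \<times> (nat \<Rightarrow> 'a)"
  have u: "?u \<in> space (paths 0)"
    by (simp add: space_pair_measure space_PiM)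
  have "rect_mass T K A B T \<in> borel_measurable (paths 0)"
    using measurable_rect_mass[of 0 A B] AB by simp
  moreover have "PiE {1..0} A \<times> PiE {1..0} B \<in> sets (paths 0)"
    by (intro pair_measureI sets_PiM_I_finite) auto
  ultimately have "(\<lambda>z. rect_mass T K A B T z * indicator (PiE {1..0} A \<times> PiE {1..0} B) z)
      \<in> borel_measurable (paths 0)"
    by measurable
  from nn_integral_return[OF u this] show ?case
    by simp
next
  case (Suc t)
  then have t: "t < T" and T: "T - t = Suc (T - Suc t)" "T - (T - Suc t) = Suc t"
    by auto
  let ?R = "\<lambda>t. PiE {1..t} A \<times> PiE {1..t} B"
  let ?m = "\<lambda>t. rect_mass T K A B (T - t)"
  have R[measurable]: "?R t \<in> sets (paths t)" if "t \<le> T" for t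
    using AB that by (intro pair_measureI sets_PiM_I_finite) auto
  have [measurable]: "?m (Suc t) \<in> borel_measurable (paths (Suc t))"
    using Suc AB by (intro measurable_rect_mass) auto
  have "(\<integral>\<^sup>+z\<in>?R (Suc t). ?m (Suc t) z \<partial>law (Suc t)) =
      (\<integral>\<^sup>+z. step (Suc t) (\<lambda>z. ?m (Suc t) z * indicator (?R (Suc t)) z) z \<partial>law t)"
    using t Suc(2) by (intro nn_integral_law_Suc) measurable
  also have "\<dots> = (\<integral>\<^sup>+z\<in>?R t. ?m t z \<partial>law t)"
  proof (rule nn_integral_cong)
    fix z assume "z \<in> space (law t)"
    then have z: "z \<in> space (paths t)"
      using t by (simp add: space_law)
    then have ext: "fst z \<in> extensional {1..t}" "snd z \<in> extensional {1..t}"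
      by (auto simp: space_pair_measure space_PiM PiE_def)
    \<comment> \<open>The indicator of a rectangle factorises into past and new coordinates, which moves the
        past factor out of the integral over the new ones.\<close>
    have upd: "x(Suc t := u) \<in> PiE {1..Suc t} S \<longleftrightarrow> x \<in> PiE {1..t} S \<and> u \<in> S (Suc t)"
      if "x \<in> extensional {1..t}" for x :: "nat \<Rightarrow> 'a" and u S
      using that by (auto simp: PiE_iff extensional_def atLeastAtMostSuc_conv split: if_splits)
    have ind: "indicator (?R (Suc t)) (extend (Suc t) z w) =
        (indicator (?R t) z * indicator (A (Suc t) \<times> B (Suc t)) w :: ennreal)" for w
      using upd[OF ext(1)] upd[OF ext(2)]
      by (cases z; cases w) (auto simp: extend_def indicator_def)
    have "step (Suc t) (\<lambda>z. ?m (Suc t) z * indicator (?R (Suc t)) z) z =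
        (\<integral>\<^sup>+w. indicator (?R t) z *
          (?m (Suc t) (extend (Suc t) z w) * indicator (A (Suc t) \<times> B (Suc t)) w) \<partial>K (Suc t) z)"
      unfolding step_def ind by (intro nn_integral_cong) (simp only: mult_ac)
    also have "\<dots> = indicator (?R t) z * ?m t z"
    proof -
      have "(\<integral>\<^sup>+w\<in>A (Suc t) \<times> B (Suc t). ?m (Suc t) (extend (Suc t) z w) \<partial>K (Suc t) z) = ?m t z"
        unfolding T(1) rect_mass.simps T(2) by (simp add: extend_def split_beta')
      then show ?thesis
        by (cases "z \<in> ?R t") (simp_all del: mem_Times_iff)
    qed
    finally show "step (Suc t) (\<lambda>z. ?m (Suc t) z * indicator (?R (Suc t)) z) z = ?m t z * indicator (?R t) z"
      by (simp add: mult.commute)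
  qed
  also have "\<dots> = rect_mass T K A B T (\<lambda>_. undefined, \<lambda>_. undefined)"
    using Suc by simp
  finally show ?case .
qed

text \<open>
  Rectangles generate the sigma algebra and are stable under intersections, so their masses
  determine the composed measure.
\<close>

lemma composition_eq_law:
  assumes sets: "sets \<pi> = sets (paths T)"
    and mass: "\<And>A B. (\<And>t. t \<in> {1..T} \<Longrightarrow> A t \<in> sets (M t) \<and> B t \<in> sets (M t)) \<Longrightarrow>
      emeasure \<pi> (PiE {1..T} A \<times> PiE {1..T} B) = rect_mass T K A B T (\<lambda>_. undefined, \<lambda>_. undefined)"
  shows "\<pi> = law T"
proof -
  define S where "S = space (PiM {1..T} M)"
  define E where "E = {PiE {1..T} A | A. A \<in> (\<Pi> t\<in>{1..T}. sets (M t))}"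
  define R where "R = {a \<times> b | a b. a \<in> E \<and> b \<in> E}"
  have E_iff: "a \<in> E \<longleftrightarrow> (\<exists>A. a = PiE {1..T} A \<and> A \<in> (\<Pi> t\<in>{1..T}. sets (M t)))" for a
    by (simp add: E_def)
  have R_iff: "G \<in> R \<longleftrightarrow> (\<exists>a b. G = a \<times> b \<and> a \<in> E \<and> b \<in> E)" for G
    by (simp add: R_def)
  have E: "E \<subseteq> Pow S" "sets (PiM {1..T} M) = sigma_sets S E"
    using prod_algebra_eq_finite[of "{1..T}" M] prod_algebra_sets_into_space[of "{1..T}" M]
    by (auto simp: space_PiM sets_PiM S_def E_def)
  have S: "S \<in> E"
    unfolding E_iff S_def by (auto simp: space_PiM intro!: exI[of _ "\<lambda>t. space (M t)"])
  have R_sub: "R \<subseteq> Pow (S \<times> S)"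
    using E(1) unfolding R_def by blast
  have "sets (paths T) = sets (sigma (S \<times> S) R)"
    unfolding S_def R_def using E S
    by (intro sets_pair_eq[where Ca = "{S}" and Cb = "{S}"]) (auto simp: S_def)
  then have gen: "sets (paths T) = sigma_sets (S \<times> S) R"
    using sets_measure_of[OF R_sub] by simp
  have Int_E: "a \<inter> b \<in> E" if ab: "a \<in> E" "b \<in> E" for a b
  proof -
    obtain A where A: "a = PiE {1..T} A" "A \<in> (\<Pi> t\<in>{1..T}. sets (M t))"
      using ab(1) unfolding E_iff by blast
    obtain B where B: "b = PiE {1..T} B" "B \<in> (\<Pi> t\<in>{1..T}. sets (M t))"
      using ab(2) unfolding E_iff by blast
    have "a \<inter> b = PiE {1..T} (\<lambda>t. A t \<inter> B t)"
      unfolding A B by (rule PiE_Int)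
    moreover have "(\<lambda>t. A t \<inter> B t) \<in> (\<Pi> t\<in>{1..T}. sets (M t))"
      using A(2) B(2) by (intro Pi_I sets.Int) (auto dest: Pi_mem)
    ultimately show ?thesis
      unfolding E_iff by blast
  qed
  have stable: "Int_stable R"
  proof (rule Int_stableI)
    fix G H assume "G \<in> R" "H \<in> R"
    then obtain a b a' b' where "G = a \<times> b" "H = a' \<times> b'" and "a \<in> E" "b \<in> E" "a' \<in> E" "b' \<in> E"
      unfolding R_iff by metis
    then show "G \<inter> H \<in> R"
      unfolding R_iff using Int_E by (metis Times_Int_Times)
  qed
  have eq: "emeasure \<pi> G = emeasure (law T) G" if G: "G \<in> R" for G
  proof -
    obtain a b where ab: "G = a \<times> b" "a \<in> E" "b \<in> E"
      using G unfolding R_iff by blast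
    obtain A where A: "a = PiE {1..T} A" "A \<in> (\<Pi> t\<in>{1..T}. sets (M t))"
      using ab(2) unfolding E_iff by blast
    obtain B where B: "b = PiE {1..T} B" "B \<in> (\<Pi> t\<in>{1..T}. sets (M t))"
      using ab(3) unfolding E_iff by blast
    have AB: "A t \<in> sets (M t) \<and> B t \<in> sets (M t)" if "t \<in> {1..T}" for t
      using that A(2) B(2) by (auto dest: Pi_mem)
    have "G \<in> sets (law T)"
      unfolding ab A B using AB by (auto simp: sets_law intro!: pair_measureI sets_PiM_I_finite)
    then have "emeasure (law T) G = (\<integral>\<^sup>+z\<in>G. rect_mass T K A B (T - T) z \<partial>law T)"
      by simp
    also have "\<dots> = emeasure \<pi> G"
      unfolding ab A B using mass[OF AB] nn_integral_law_rect_mass[OF order_refl AB] by simp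
    finally show ?thesis
      by simp
  qed
  have SS: "S \<times> S \<in> R"
    using S unfolding R_iff by blast
  have "S \<times> S = space (law T)"
    by (simp add: space_law space_pair_measure S_def)
  then have fin: "emeasure \<pi> (S \<times> S) \<noteq> \<infinity>"
    using eq[OF SS] prob_space.emeasure_space_1[OF prob_space_law[of T]] by simp
  show ?thesis
  proof (rule measure_eqI_generator_eq[OF stable R_sub eq, of "\<lambda>_. S \<times> S"])
    show "sets \<pi> = sigma_sets (S \<times> S) R" "sets (law T) = sigma_sets (S \<times> S) R"
      using sets gen sets_law[of T] by simp_all
  qed (use fin SS in auto)
qed

text \<open>
  The Markov property, for nonnegative functions: an event \<open>truncate t -` B\<close> of the past is a
  constant for the kernel of stage \<open>t + 1\<close>, so that averaging over that kernel preserves the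
  integral over the event.
\<close>

lemma nn_cond_exp_truncate:
  assumes t: "t < T"
    and F: "subalgebra (law T) F" "truncate t \<in> F \<rightarrow>\<^sub>M paths t"
      "\<And>A. A \<in> sets F \<Longrightarrow> \<exists>B\<in>sets (paths t). A = truncate t -` B \<inter> space F"
    and f: "f \<in> borel_measurable (paths (Suc t))"
  shows "AE z in law T. step (Suc t) f (truncate t z) =
    nn_cond_exp (law T) F (\<lambda>z. f (truncate (Suc t) z)) z"
proof -
  interpret L: prob_space "law T"
    by (simp add: prob_space_law)
  interpret finite_measure_subalgebra "law T" F
    by unfold_locales (rule F(1))
  have trunc: "truncate s \<in> law T \<rightarrow>\<^sub>M paths s" if "s \<le> T" for s
    using measurable_truncate[OF that] by (simp add: sets_law cong: measurable_cong_sets)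
  show ?thesis
  proof (rule nn_cond_exp_charact)
    fix A assume "A \<in> sets F"
    then obtain B where B[measurable]: "B \<in> sets (paths t)" and A: "A = truncate t -` B \<inter> space (law T)"
      using F by (auto simp: subalgebra_def)
    let ?g = "\<lambda>z. f z * indicator B (truncate t z)"
    have g: "?g \<in> borel_measurable (paths (Suc t))"
      using f measurable_truncate[of t "Suc t"] by measurable
    have "(\<integral>\<^sup>+z\<in>A. f (truncate (Suc t) z) \<partial>law T) = (\<integral>\<^sup>+z. ?g (truncate (Suc t) z) \<partial>law T)"
      by (intro nn_integral_cong) (auto simp: A truncate_truncate indicator_def)
    also have "\<dots> = (\<integral>\<^sup>+z. ?g z \<partial>law (Suc t))"
      using t g by (intro nn_integral_law_truncate) auto
    also have "\<dots> = (\<integral>\<^sup>+z. step (Suc t) ?g z \<partial>law t)"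
      by (rule nn_integral_law_Suc[OF t g])
    also have "\<dots> = (\<integral>\<^sup>+z. step (Suc t) f z * indicator B z \<partial>law t)"
      using t by (intro nn_integral_cong)
        (auto simp: step_def truncate_extend truncate_paths space_law indicator_def)
    also have "\<dots> = (\<integral>\<^sup>+z. step (Suc t) f (truncate t z) * indicator B (truncate t z) \<partial>law T)"
      using t B measurable_step[OF t f]
      by (intro nn_integral_law_truncate[symmetric] borel_measurable_times_ennreal
          borel_measurable_indicator) auto
    also have "\<dots> = (\<integral>\<^sup>+z\<in>A. step (Suc t) f (truncate t z) \<partial>law T)"
      by (intro nn_integral_cong) (auto simp: A indicator_def)
    finally show "(\<integral>\<^sup>+z\<in>A. f (truncate (Suc t) z) \<partial>law T) =
        (\<integral>\<^sup>+z\<in>A. step (Suc t) f (truncate t z) \<partial>law T)" .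
  next
    show "(\<lambda>z. f (truncate (Suc t) z)) \<in> borel_measurable (law T)"
      using t by (intro measurable_compose[OF trunc f]) auto
    show "(\<lambda>z. step (Suc t) f (truncate t z)) \<in> borel_measurable F"
      by (rule measurable_compose[OF F(2) measurable_step[OF t f]])
  qed
qed

end


section \<open>Coordinates entering the cost process and the filtration\<close>

text \<open>
  Agreement is required outside \<open>{1..T}\<close> too, since the terminal cost is applied to paths as
  functions on all of \<open>nat\<close>.
\<close>

lemma cost_backward_cong:
  assumes "n \<le> T"
    and "\<And>s. s \<notin> {T - n<..T} \<Longrightarrow> x s = x' s" "\<And>s. s \<notin> {T - n<..T} \<Longrightarrow> y s = y' s"
  shows "cost_backward T r p q c n (x, y) = cost_backward T r p q c n (x', y')"
  using assms
proof (induction n arbitrary: x x' y y')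
  case 0
  then have "x = x'" "y = y'"
    by (auto simp: fun_eq_iff)
  then show ?case
    by simp
next
  case (Suc n)
  have off: "s \<notin> {T - Suc n<..T}" if "s \<in> {1..<T - n}" for s
    using that by auto
  have restr: "restrict x {1..<T - n} = restrict x' {1..<T - n}"
    "restrict y {1..<T - n} = restrict y' {1..<T - n}"
    using Suc.prems(2,3)[OF off] by (intro restrict_ext; blast)+
  have "cost_backward T r p q c n (x(T - n := u), y(T - n := v)) =
      cost_backward T r p q c n (x'(T - n := u), y'(T - n := v))" for u v
    using Suc.prems by (intro Suc.IH) auto
  then show ?case
    using restr by (simp add: stage_cost_def)
qed

text \<open>
  A path and its truncation agree outside \<open>{1..T}\<close>, where both are \<open>undefined\<close>, and overwriting the
  coordinates after \<open>t\<close> turns the truncation into a path of full length again.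
\<close>

lemma cost_process_truncate:
  assumes "t \<le> T" "z \<in> path_space X T \<times> path_space X T"
  shows "cost_process T r p q c t (truncate t z) = cost_process T r p q c t z"
proof -
  have ext: "fst z \<in> extensional {1..T}" "snd z \<in> extensional {1..T}"
    using assms by (auto simp: path_space_def PiE_def)
  have "cost_backward T r p q c (T - t) (restrict (fst z) {1..t}, restrict (snd z) {1..t}) =
      cost_backward T r p q c (T - t) (fst z, snd z)"
    using assms ext by (intro cost_backward_cong) (auto simp: restrict_def extensional_def)
  then show ?thesis
    by (simp add: cost_process_def truncate_def)
qed

lemma space_coord_algebra: "space (coord_algebra X T t) = path_space X T"
  by (simp add: coord_algebra_def)

lemma space_path_algebra: "space (path_algebra X {1..T}) = path_space X T"
  by (simp add: space_PiM path_space_def)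

lemma sets_coord_algebra_terminal: "sets (coord_algebra X T T) = sets (path_algebra X {1..T})"
proof -
  have "sets (coord_algebra X T T) =
      {(\<lambda>x. restrict x {1..T}) -` A \<inter> path_space X T | A. A \<in> sets (path_algebra X {1..T})}"
    unfolding coord_algebra_def
    by (rule sets_vimage_algebra2) (auto simp: space_PiM path_space_def)
  also have "\<dots> = (\<lambda>A. A) ` sets (path_algebra X {1..T})"
    unfolding Setcompr_eq_image
  proof (rule image_cong)
    fix A assume A: "A \<in> sets (path_algebra X {1..T})"
    have "restrict x {1..T} = x" if "x \<in> path_space X T" for x
      using that unfolding path_space_def by (rule PiE_restrict)
    then show "(\<lambda>x. restrict x {1..T}) -` A \<inter> path_space X T = A"
      using sets.sets_into_space[OF A] unfolding space_path_algebra by auto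
  qed simp
  finally show ?thesis
    by simp
qed

lemma measurable_truncate_canonical_filtration:
  assumes "t \<le> T"
  shows "truncate t \<in> canonical_filtration X T t \<rightarrow>\<^sub>M path_algebra X {1..t} \<Otimes>\<^sub>M path_algebra X {1..t}"
proof -
  have "(\<lambda>x. restrict x {1..t}) \<in> coord_algebra X T t \<rightarrow>\<^sub>M path_algebra X {1..t}"
    unfolding coord_algebra_def using assms
    by (intro measurable_vimage_algebra1) (auto simp: space_PiM path_space_def)
  then show ?thesis
    unfolding canonical_filtration_def truncate_def by measurable
qed

text \<open>
  The filtration is a product of two pulled back sigma algebras, whereas the Markov property speaks
  of a single pullback along \<open>truncate t\<close>.  The product is contained in the latter because both
  projections are measurable for it.
\<close>

lemma sets_canonical_filtration:
  assumes "t \<le> T" "A \<in> sets (canonical_filtration X T t)"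
  shows "\<exists>B\<in>sets (path_algebra X {1..t} \<Otimes>\<^sub>M path_algebra X {1..t}).
    A = truncate t -` B \<inter> space (canonical_filtration X T t)"
proof -
  let ?\<Omega> = "path_space X T \<times> path_space X T"
  let ?V = "vimage_algebra ?\<Omega> (truncate t) (path_algebra X {1..t} \<Otimes>\<^sub>M path_algebra X {1..t})"
  have trunc: "truncate t \<in> ?\<Omega> \<rightarrow> space (path_algebra X {1..t} \<Otimes>\<^sub>M path_algebra X {1..t})"
    using assms(1) by (auto simp: truncate_def space_pair_measure space_PiM path_space_def PiE_iff)
  then have V: "truncate t \<in> ?V \<rightarrow>\<^sub>M path_algebra X {1..t} \<Otimes>\<^sub>M path_algebra X {1..t}"
    by (rule measurable_vimage_algebra1)
  have "(\<lambda>z. z) \<in> ?V \<rightarrow>\<^sub>M canonical_filtration X T t"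
    unfolding canonical_filtration_def
  proof (rule measurable_pair)
    show "fst \<circ> (\<lambda>z. z) \<in> ?V \<rightarrow>\<^sub>M coord_algebra X T t"
      unfolding coord_algebra_def
      using measurable_compose[OF V measurable_fst]
      by (intro measurable_vimage_algebra2) (auto simp: truncate_def)
    show "snd \<circ> (\<lambda>z. z) \<in> ?V \<rightarrow>\<^sub>M coord_algebra X T t"
      unfolding coord_algebra_def
      using measurable_compose[OF V measurable_snd]
      by (intro measurable_vimage_algebra2) (auto simp: truncate_def)
  qed
  from measurable_sets[OF this assms(2)] have "A \<in> sets ?V"
    using sets.sets_into_space[OF assms(2)]
    by (simp add: canonical_filtration_def space_pair_measure space_coord_algebra Int_absorb2)
  then show ?thesis
    unfolding sets_vimage_algebra2[OF trunc]
    by (auto simp: canonical_filtration_def space_pair_measure space_coord_algebra)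
qed

lemma subalgebra_canonical_filtration:
  assumes "t \<le> T" "space N = path_space X T \<times> path_space X T"
    and "truncate t \<in> N \<rightarrow>\<^sub>M path_algebra X {1..t} \<Otimes>\<^sub>M path_algebra X {1..t}"
  shows "subalgebra N (canonical_filtration X T t)"
proof -
  have space: "space (canonical_filtration X T t) = space N"
    by (simp add: assms(2) canonical_filtration_def space_pair_measure space_coord_algebra)
  have "A \<in> sets N" if A: "A \<in> sets (canonical_filtration X T t)" for A
  proof -
    obtain B where "B \<in> sets (path_algebra X {1..t} \<Otimes>\<^sub>M path_algebra X {1..t})"
        "A = truncate t -` B \<inter> space N"
      using sets_canonical_filtration[OF assms(1) A] unfolding space by blast
    then show ?thesis
      using measurable_sets[OF assms(3)] by blast
  qed
  then show ?thesis
    using space by (auto simp: subalgebra_def)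
qed


section \<open>The cost process under the optimal kernels\<close>

locale optimal_transport_chain =
  fixes X :: "nat \<Rightarrow> 'a topology"
    and T :: nat
    and r :: real
    and p q :: "nat \<Rightarrow> (nat \<Rightarrow> 'a) \<Rightarrow> 'a measure"
    and c :: "(nat \<Rightarrow> 'a) \<times> (nat \<Rightarrow> 'a) \<Rightarrow> real"
    and k :: "nat \<Rightarrow> (nat \<Rightarrow> 'a) \<times> (nat \<Rightarrow> 'a) \<Rightarrow> ('a \<times> 'a) measure"
  assumes r: "1 \<le> r"
    and c: "c \<in> borel_measurable (path_algebra X {1..T} \<Otimes>\<^sub>M path_algebra X {1..T})"
    and k: "optimal_kernels X T r p q c k"
begin

sublocale path_pair_kernels "\<lambda>t. borel_of (X t)" k T
proof
  fix t assume "t < T"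
  then have "Suc t \<in> {1..T}"
    by simp
  then show "k (Suc t) \<in> path_algebra X {1..t} \<Otimes>\<^sub>M path_algebra X {1..t}
      \<rightarrow>\<^sub>M prob_algebra (borel_of (X (Suc t)) \<Otimes>\<^sub>M borel_of (X (Suc t)))"
    using k unfolding optimal_kernels_def by (metis atLeastLessThanSuc_atLeastAtMost)
qed

abbreviation F :: "nat \<Rightarrow> ((nat \<Rightarrow> 'a) \<times> (nat \<Rightarrow> 'a)) measure" where
  "F \<equiv> canonical_filtration X T"

definition C :: "nat \<Rightarrow> (nat \<Rightarrow> 'a) \<times> (nat \<Rightarrow> 'a) \<Rightarrow> ereal" where
  "C t z = ereal_pow (cost_process T r p q c t z) r"

lemma space_law_terminal: "space (law T) = path_space X T \<times> path_space X T"
  unfolding space_law[OF order_refl] space_pair_measure space_path_algebra ..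

lemma C_terminal: "C T z = ereal (real_pow (c z) r)"
  by (simp add: C_def cost_process_terminal ereal_pow_def)

lemma C_step:
  assumes t: "t < T" and z: "z \<in> space (paths t)"
  shows "C t z = ereal_integral (k (Suc t) z) (\<lambda>w. C (Suc t) (extend (Suc t) z w))"
proof -
  obtain x y where xy: "z = (x, y)" "x \<in> space (path_algebra X {1..t})" "y \<in> space (path_algebra X {1..t})"
    using z by (auto simp: space_pair_measure)
  have restr: "restrict x {1..<Suc t} = x" "restrict y {1..<Suc t} = y"
    using xy by (auto simp: space_PiM atLeastLessThanSuc_atLeastAtMost)
  let ?s = "stage_cost (Suc t) x y (cost_process T r p q c (Suc t))"
  have "Suc t \<in> {1..T}"
    using t by simp
  then have "optimal_coupling r (p (Suc t) x) (q (Suc t) y) ?s (k (Suc t) (x, y))"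
    using k xy unfolding optimal_kernels_def by (metis atLeastLessThanSuc_atLeastAtMost)
  then have "cost_process T r p q c t z = transport_cost r (k (Suc t) z) ?s"
    using cost_process_step[of "Suc t" T r p q c x y] t restr
    by (simp add: xy optimal_coupling_def)
  then show ?thesis
    using r by (simp add: C_def ereal_pow_transport_cost stage_cost_eq_extend xy)
qed

lemma C_parts:
  assumes "t < T" "z \<in> space (paths t)"
  shows "C t z = enn2ereal (step (Suc t) (\<lambda>z. e2ennreal (C (Suc t) z)) z) -
    enn2ereal (step (Suc t) (\<lambda>z. e2ennreal (- C (Suc t) z)) z)"
  unfolding C_step[OF assms] step_def ereal_integral_def ..

text \<open>
  Measurability is read off the attained value \<open>C_step\<close>, not off the infimum.
\<close>

lemma measurable_C_paths:
  assumes "t \<le> T"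
  shows "C t \<in> borel_measurable (paths t)"
  using assms
proof (induction t rule: inc_induct)
  case base
  show ?case
    unfolding C_terminal[abs_def] using c by measurable
next
  case (step t)
  note [measurable] = step(3)
  have "(\<lambda>z. e2ennreal (C (Suc t) z)) \<in> borel_measurable (paths (Suc t))"
    "(\<lambda>z. e2ennreal (- C (Suc t) z)) \<in> borel_measurable (paths (Suc t))"
    by measurable
  then have [measurable]: "step (Suc t) (\<lambda>z. e2ennreal (C (Suc t) z)) \<in> borel_measurable (paths t)"
    "step (Suc t) (\<lambda>z. e2ennreal (- C (Suc t) z)) \<in> borel_measurable (paths t)"
    using step(2) by (blast intro: measurable_step)+
  have "(\<lambda>z. enn2ereal (step (Suc t) (\<lambda>z. e2ennreal (C (Suc t) z)) z) -
      enn2ereal (step (Suc t) (\<lambda>z. e2ennreal (- C (Suc t) z)) z)) \<in> borel_measurable (paths t)"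
    by measurable
  then show ?case
    by (subst measurable_cong[OF C_parts[OF step(2)]])
qed

lemma C_nonneg:
  assumes "t \<le> T" "\<And>z. z \<in> space (paths T) \<Longrightarrow> 0 \<le> c z" "z \<in> space (paths t)"
  shows "0 \<le> C t z"
  using assms(1,3)
proof (induction t arbitrary: z rule: inc_induct)
  case base
  then show ?case
    using assms(2)[of z] by (simp add: C_terminal real_pow_nonneg)
next
  case (step t)
  have "0 \<le> C (Suc t) (extend (Suc t) z w)" if "w \<in> space (k (Suc t) z)" for w
    using that step by (intro step.IH extend_paths)
  then show ?case
    using step by (simp add: C_step ereal_integral_nonneg)
qed

lemma C_truncate:
  assumes "t \<le> T" "z \<in> space (law T)"
  shows "C t (truncate t z) = C t z"
  using assms by (simp add: C_def cost_process_truncate[where X = X] space_law_terminal)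

lemma measurable_truncate_law: "t \<le> T \<Longrightarrow> truncate t \<in> law T \<rightarrow>\<^sub>M paths t"
  using measurable_truncate[of t T] by (simp add: sets_law cong: measurable_cong_sets)

lemma space_F: "space (F t) = space (law T)"
  by (simp add: canonical_filtration_def space_pair_measure space_coord_algebra space_law_terminal)

lemma subalgebra_law: "t \<le> T \<Longrightarrow> subalgebra (law T) (F t)"
  by (intro subalgebra_canonical_filtration measurable_truncate_law) (simp_all add: space_law_terminal)

lemma subalgebra_F:
  assumes "s \<le> t" "t \<le> T"
  shows "subalgebra (F t) (F s)"
proof (intro subalgebra_canonical_filtration)
  have "(\<lambda>z. truncate s (truncate t z)) \<in> F t \<rightarrow>\<^sub>M paths s"
    using assms by (intro measurable_compose[OF measurable_truncate_canonical_filtration measurable_truncate])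
  then show "truncate s \<in> F t \<rightarrow>\<^sub>M paths s"
    using assms by (simp add: truncate_truncate)
qed (use assms in \<open>simp_all add: space_F space_law_terminal\<close>)

lemma measurable_C_F:
  assumes "t \<le> T"
  shows "C t \<in> borel_measurable (F t)"
proof -
  have "(\<lambda>z. C t (truncate t z)) \<in> borel_measurable (F t)"
    using assms
    by (intro measurable_compose[OF measurable_truncate_canonical_filtration measurable_C_paths])
  then show ?thesis
    using assms by (subst measurable_cong[OF C_truncate[symmetric]]) (auto simp: space_F)
qed

lemma measurable_C_law: "t \<le> T \<Longrightarrow> C t \<in> borel_measurable (law T)"
  using measurable_from_subalg[OF subalgebra_law measurable_C_F] .

lemma finite_measure_subalgebra_law: "t \<le> T \<Longrightarrow> finite_measure_subalgebra (law T) (F t)"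
  using subalgebra_law prob_space_law[of T]
  by (auto simp: finite_measure_subalgebra_def finite_measure_subalgebra_axioms_def
      prob_space.finite_measure)

lemma sigma_finite_subalgebra_law: "t \<le> T \<Longrightarrow> sigma_finite_subalgebra (law T) (F t)"
  by (intro finite_measure_subalgebra_is_sigma_finite finite_measure_subalgebra_law)

text \<open>
  The parameter \<open>f\<close> will be the positive or the negative part.
\<close>

lemma nn_cond_exp_C:
  assumes t: "t < T" and f[measurable]: "f \<in> borel_measurable borel"
  shows "AE z in law T. nn_cond_exp (law T) (F t) (\<lambda>z. f (C (Suc t) z)) z =
    step (Suc t) (\<lambda>z. f (C (Suc t) z)) (truncate t z)"
proof -
  interpret sigma_finite_subalgebra "law T" "F t"
    using t by (intro sigma_finite_subalgebra_law) simp
  have [measurable]: "C (Suc t) \<in> borel_measurable (law T)"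
    using t by (intro measurable_C_law) simp
  have fC: "(\<lambda>z. f (C (Suc t) z)) \<in> borel_measurable (paths (Suc t))"
    using t by (intro measurable_compose[OF measurable_C_paths f]) simp
  have "AE z in law T. step (Suc t) (\<lambda>z. f (C (Suc t) z)) (truncate t z) =
      nn_cond_exp (law T) (F t) (\<lambda>z. f (C (Suc t) (truncate (Suc t) z))) z"
    using t
    by (intro nn_cond_exp_truncate[OF t _ _ _ fC] subalgebra_law
        measurable_truncate_canonical_filtration sets_canonical_filtration) auto
  moreover have "AE z in law T. nn_cond_exp (law T) (F t) (\<lambda>z. f (C (Suc t) (truncate (Suc t) z))) z =
      nn_cond_exp (law T) (F t) (\<lambda>z. f (C (Suc t) z)) z"
    using t fC measurable_truncate_law[of "Suc t"]
    by (intro nn_cond_exp_cong AE_I2) (auto simp: C_truncate intro: measurable_compose)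
  ultimately show ?thesis
    by eventually_elim simp
qed

lemma C_parts_truncate:
  assumes t: "t < T" and z: "z \<in> space (law T)"
  shows "C t z = enn2ereal (step (Suc t) (\<lambda>z. e2ennreal (C (Suc t) z)) (truncate t z)) -
    enn2ereal (step (Suc t) (\<lambda>z. e2ennreal (- C (Suc t) z)) (truncate t z))"
  using C_parts[OF t measurable_space[OF measurable_truncate_law z]] C_truncate[OF _ z] t by simp

text \<open>
  For a nonnegative terminal cost the negative parts vanish, and the identity for the positive
  parts holds with the value \<open>\<infinity>\<close> included.
\<close>

lemma nn_cond_exp_step:
  assumes t: "t < T" and c: "\<And>z. z \<in> space (paths T) \<Longrightarrow> 0 \<le> c z"
  shows "AE z in law T. e2ennreal (C t z) = nn_cond_exp (law T) (F t) (\<lambda>z. e2ennreal (C (Suc t) z)) z"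
proof -
  have "C t z = enn2ereal (step (Suc t) (\<lambda>z. e2ennreal (C (Suc t) z)) (truncate t z))"
    if z: "z \<in> space (law T)" for z
  proof -
    have tz: "truncate t z \<in> space (paths t)"
      using measurable_space[OF measurable_truncate_law z] t by simp
    have "C t (truncate t z) = enn2ereal (step (Suc t) (\<lambda>z. e2ennreal (C (Suc t) z)) (truncate t z))"
      unfolding C_step[OF t tz] step_def
      using t c by (intro ereal_integral_nonneg C_nonneg extend_paths tz) auto
    then show ?thesis
      using t z by (simp add: C_truncate)
  qed
  with nn_cond_exp_C[OF t measurable_e2ennreal] show ?thesis
    by (auto elim!: AE_mp)
qed

text \<open>
  Conditional expectation preserves the finite integrals of the positive and the negative part, so
  both conditional expectations are finite almost everywhere.  Their difference is then at the same
  time \<open>C t\<close> and the real conditional expectation.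
\<close>

lemma real_cond_exp_step:
  assumes t: "t < T"
    and fin: "AE z in law T. \<bar>C (Suc t) z\<bar> \<noteq> \<infinity>"
    and int: "integrable (law T) (\<lambda>z. real_of_ereal (C (Suc t) z))"
  shows "AE z in law T. \<bar>C t z\<bar> \<noteq> \<infinity>"
    and "integrable (law T) (\<lambda>z. real_of_ereal (C t z))"
    and "AE z in law T. real_of_ereal (C t z) =
      real_cond_exp (law T) (F t) (\<lambda>z. real_of_ereal (C (Suc t) z)) z"
proof -
  interpret sigma_finite_subalgebra "law T" "F t"
    using t by (intro sigma_finite_subalgebra_law) simp
  let ?f = "\<lambda>z. real_of_ereal (C (Suc t) z)"
  let ?U = "\<lambda>z. e2ennreal (C (Suc t) z)" and ?V = "\<lambda>z. e2ennreal (- C (Suc t) z)"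
  let ?u = "nn_cond_exp (law T) (F t) (\<lambda>z. ennreal (?f z))"
  let ?v = "nn_cond_exp (law T) (F t) (\<lambda>z. ennreal (- ?f z))"
  have [measurable]: "C (Suc t) \<in> borel_measurable (law T)" "C t \<in> borel_measurable (law T)"
    using t by (simp_all add: measurable_C_law)
  have neg: "(\<lambda>x. e2ennreal (- x)) \<in> borel_measurable borel"
    by measurable
  have UV: "AE z in law T. ?U z = ennreal (?f z) \<and> ?V z = ennreal (- ?f z)"
    using fin
  proof eventually_elim
    case (elim z)
    then show ?case
      by (cases "C (Suc t) z") (simp_all add: ennreal.abs_eq)
  qed
  have "AE z in law T. nn_cond_exp (law T) (F t) ?U z = ?u z"
    using UV by (intro nn_cond_exp_cong) auto
  moreover have "AE z in law T. nn_cond_exp (law T) (F t) ?V z = ?v z"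
    using UV by (intro nn_cond_exp_cong) auto
  moreover note nn_cond_exp_C[OF t measurable_e2ennreal] nn_cond_exp_C[OF t neg]
  moreover have "AE z in law T. C t z =
      enn2ereal (step (Suc t) ?U (truncate t z)) - enn2ereal (step (Suc t) ?V (truncate t z))"
    using C_parts_truncate[OF t] by (intro AE_I2)
  ultimately have parts: "AE z in law T. C t z = enn2ereal (?u z) - enn2ereal (?v z)"
    by eventually_elim metis
  have "(\<integral>\<^sup>+z. ennreal (?f z) \<partial>law T) \<noteq> \<infinity>" "(\<integral>\<^sup>+z. ennreal (- ?f z) \<partial>law T) \<noteq> \<infinity>"
    using int by (auto simp: real_integrable_def)
  then have uv: "(\<integral>\<^sup>+z. ?u z \<partial>law T) \<noteq> \<infinity>" "(\<integral>\<^sup>+z. ?v z \<partial>law T) \<noteq> \<infinity>"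
    using nn_cond_exp_intg[of "\<lambda>_. 1"] by simp_all
  have "AE z in law T. ?u z \<noteq> \<infinity>" "AE z in law T. ?v z \<noteq> \<infinity>"
    by (rule nn_integral_PInf_AE[OF borel_measurable_nn_cond_exp2 uv(1)],
        rule nn_integral_PInf_AE[OF borel_measurable_nn_cond_exp2 uv(2)])
  with parts have "AE z in law T. \<bar>C t z\<bar> \<noteq> \<infinity> \<and> real_of_ereal (C t z) = real_cond_exp (law T) (F t) ?f z"
  proof eventually_elim
    case (elim z)
    obtain a where a: "?u z = ennreal a" "0 \<le> a"
      using elim(2) by (cases "?u z") auto
    obtain b where b: "?v z = ennreal b" "0 \<le> b"
      using elim(3) by (cases "?v z") auto
    show ?case
      unfolding elim(1) real_cond_exp_def a b using a(2) b(2) by (simp add: enn2ereal_ennreal)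
  qed
  then show "AE z in law T. \<bar>C t z\<bar> \<noteq> \<infinity>"
    and eq: "AE z in law T. real_of_ereal (C t z) = real_cond_exp (law T) (F t) ?f z"
    by auto
  show "integrable (law T) (\<lambda>z. real_of_ereal (C t z))"
    using real_cond_exp_int(1)[OF int] eq by (subst integrable_cong_AE[OF _ _ eq]) auto
qed

lemma integrable_C:
  assumes "t \<le> T" "integrable (law T) (\<lambda>z. real_pow (c z) r)"
  shows "(AE z in law T. \<bar>C t z\<bar> \<noteq> \<infinity>) \<and> integrable (law T) (\<lambda>z. real_of_ereal (C t z))"
  using assms(1)
proof (induction t rule: inc_induct)
  case base
  then show ?case
    using assms(2) by (simp add: C_terminal)
next
  case (step t)
  then show ?case
    using real_cond_exp_step(1,2)[of t] by simp
qed

text \<open>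
  One-step martingale identities combine by the tower property.
\<close>

lemma real_cond_exp_C:
  assumes "s \<le> t" "t \<le> T" and int: "integrable (law T) (\<lambda>z. real_pow (c z) r)"
  shows "AE z in law T. real_of_ereal (C s z) =
    real_cond_exp (law T) (F s) (\<lambda>z. real_of_ereal (C t z)) z"
  using assms(1,2)
proof (induction s rule: inc_induct)
  case base
  interpret sigma_finite_subalgebra "law T" "F t"
    using base by (intro sigma_finite_subalgebra_law) simp
  have "(\<lambda>z. real_of_ereal (C t z)) \<in> borel_measurable (F t)"
    using measurable_C_F[OF base] by measurable
  with integrable_C[OF base int] show ?case
    by (auto dest!: real_cond_exp_F_meas[rotated] elim!: AE_mp)
next
  case (step s)
  have s: "s < T" "Suc s \<le> T" "s \<le> T"
    using step by auto
  interpret sigma_finite_subalgebra "law T" "F s"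
    using s by (intro sigma_finite_subalgebra_law) simp
  let ?Z = "\<lambda>t z. real_of_ereal (C t z)"
  have [measurable]: "?Z (Suc s) \<in> borel_measurable (law T)"
    using measurable_C_law[OF s(2)] by measurable
  have "AE z in law T. ?Z s z = real_cond_exp (law T) (F s) (?Z (Suc s)) z"
    using integrable_C[OF s(2) int] by (intro real_cond_exp_step(3)[OF s(1)]) blast+
  moreover have "AE z in law T. real_cond_exp (law T) (F s) (?Z (Suc s)) z =
      real_cond_exp (law T) (F s) (real_cond_exp (law T) (F (Suc s)) (?Z t)) z"
    using step by (intro real_cond_exp_cong) auto
  moreover have "AE z in law T. real_cond_exp (law T) (F s) (real_cond_exp (law T) (F (Suc s)) (?Z t)) z =
      real_cond_exp (law T) (F s) (?Z t) z"
    using integrable_C[OF step(4) int] s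
    by (intro real_cond_exp_nested_subalg subalgebra_law subalgebra_F) auto
  ultimately show ?case
    by eventually_elim simp
qed

end


section \<open>The martingale property\<close>

theorem theorem24:
  fixes X :: "nat \<Rightarrow> 'a topology"
    and T :: nat
    and d :: "(nat \<Rightarrow> 'a) \<Rightarrow> (nat \<Rightarrow> 'a) \<Rightarrow> real"
    and P Q :: "(nat \<Rightarrow> 'a) measure"
    and p q :: "nat \<Rightarrow> (nat \<Rightarrow> 'a) \<Rightarrow> 'a measure"
    and c :: "(nat \<Rightarrow> 'a) \<times> (nat \<Rightarrow> 'a) \<Rightarrow> real"
    and r :: real
    and k :: "nat \<Rightarrow> (nat \<Rightarrow> 'a) \<times> (nat \<Rightarrow> 'a) \<Rightarrow> ('a \<times> 'a) measure"
    and \<pi> :: "((nat \<Rightarrow> 'a) \<times> (nat \<Rightarrow> 'a)) measure"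
  defines "\<Xi> \<equiv> path_space X T"
    and "F \<equiv> canonical_filtration X T"
    and "C \<equiv> \<lambda>t z. ereal_pow (cost_process T r p q c t z) r"
  assumes T: "1 \<le> T"
    and r: "1 \<le> r"
    and polish: "\<And>t. t \<in> {1..T} \<Longrightarrow> polish_topology (X t)"
    and metric: "Metric_space \<Xi> d"
    and polish_product: "polish_topology (Metric_space.mtopology \<Xi> d)"
    and borel_product: "sets (coord_algebra X T T) = sets (borel_of (Metric_space.mtopology \<Xi> d))"
    and P: "prob_space P" "sets P = sets (path_algebra X {1..T})"
    and Q: "prob_space Q" "sets Q = sets (path_algebra X {1..T})"
    and p: "is_disintegration X T P p"
    and q: "is_disintegration X T Q q"
    and c: "lower_semicontinuous
              (prod_topology (Metric_space.mtopology \<Xi> d) (Metric_space.mtopology \<Xi> d)) c"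
    and k: "optimal_kernels X T r p q c k"
    and pi: "is_composition X T k \<pi>"
  shows
    "(integrable \<pi> (\<lambda>z. real_pow (c z) r) \<longrightarrow>
        (\<forall>t\<in>{1..T}. AE z in \<pi>. \<bar>C t z\<bar> \<noteq> \<infinity>) \<and>
        martingale_on \<pi> {1..T} F (\<lambda>t z. real_of_ereal (C t z)) \<and>
        (\<forall>t\<in>{1..<T}. AE z in \<pi>. real_of_ereal (C t z) =
           real_cond_exp \<pi> (F t) (\<lambda>z. real_of_ereal (C (t + 1) z)) z)) \<and>
     ((\<forall>z\<in>\<Xi> \<times> \<Xi>. 0 \<le> c z) \<longrightarrow>
        (\<forall>t\<in>{1..<T}. AE z in \<pi>. e2ennreal (C t z) =
           nn_cond_exp \<pi> (F t) (\<lambda>z. e2ennreal (C (t + 1) z)) z))"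
proof -
  interpret Metric_space \<Xi> d
    by (rule metric)
  have "second_countable mtopology"
    by (rule second_countable_mtopology[OF polish_product])
  then have "c \<in> borel_measurable (borel_of mtopology \<Otimes>\<^sub>M borel_of mtopology)"
    using c by (intro lower_semicontinuous_borel_measurable)
  moreover have "sets (borel_of mtopology \<Otimes>\<^sub>M borel_of mtopology) =
      sets (path_algebra X {1..T} \<Otimes>\<^sub>M path_algebra X {1..T})"
    using borel_product sets_coord_algebra_terminal[of X T] by (intro sets_pair_measure_cong) auto
  ultimately have "c \<in> borel_measurable (path_algebra X {1..T} \<Otimes>\<^sub>M path_algebra X {1..T})"
    by (simp cong: measurable_cong_sets)
  then interpret O: optimal_transport_chain X T r p q c k
    using r k by unfold_locales
  have law: "\<pi> = O.law T"
    using pi unfolding is_composition_def by (intro O.composition_eq_law) auto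
  have C: "C = O.C"
    by (simp add: C_def O.C_def fun_eq_iff)
  have nonneg: "AE z in \<pi>. e2ennreal (C t z) = nn_cond_exp \<pi> (F t) (\<lambda>z. e2ennreal (C (t + 1) z)) z"
    if "\<forall>z\<in>\<Xi> \<times> \<Xi>. 0 \<le> c z" "t \<in> {1..<T}" for t
    using that O.nn_cond_exp_step[of t]
    unfolding law C F_def \<Xi>_def O.space_law_terminal[symmetric] O.space_law[OF order_refl] by simp
  have integrable: "(\<forall>t\<in>{1..T}. AE z in \<pi>. \<bar>C t z\<bar> \<noteq> \<infinity>) \<and>
      martingale_on \<pi> {1..T} F (\<lambda>t z. real_of_ereal (C t z)) \<and>
      (\<forall>t\<in>{1..<T}. AE z in \<pi>. real_of_ereal (C t z) =
         real_cond_exp \<pi> (F t) (\<lambda>z. real_of_ereal (C (t + 1) z)) z)"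
    if int: "integrable \<pi> (\<lambda>z. real_pow (c z) r)"
  proof -
    have int': "integrable (O.law T) (\<lambda>z. real_pow (c z) r)"
      using int law by simp
    have "martingale_on (O.law T) {1..T} O.F (\<lambda>t z. real_of_ereal (O.C t z))"
      unfolding martingale_on_def
      using O.integrable_C[OF _ int'] O.real_cond_exp_C[OF _ _ int'] O.subalgebra_law O.subalgebra_F
        borel_measurable_real_of_ereal[OF O.measurable_C_F] by auto
    then show ?thesis
      unfolding law C F_def using O.integrable_C[OF _ int'] O.real_cond_exp_C[OF _ _ int'] by simp
  qed
  show ?thesis
    using integrable nonneg by blast
qed

end
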